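(* Let $1<p,q<\infty$, $t_0>0$, $\lambda>0$, and let $u(t)$ be a solution, positive on $(0,t_0)$, of $$\big(\operatorname{sgn}(u'')|u''|^{p-1}\big)''=\lambda\, \operatorname{sgn}(u)|u|^{q-1}\quad (0\le t\le t_0),\qquad u(0)=u(t_0)=u''(0)=u''(t_0)=0.$$ Then $u(t)=u(t_0-t)$ for all $0<t<\frac{t_0}2$. Moreover, $u$ can be extended to a $2t_0$-periodic function $u_*\in C^1(\mathbb R)$ satisfying $$\big(\operatorname{sgn}(u_*''(t))|u_*''(t)|^{p-1}\big)''=\lambda\, \operatorname{sgn}(u_*(t))|u_*(t)|^{q-1}\qquad\text{for all }t\in\mathbb R.$$
   Context: Solutions on an interval are understood in the sense that $u$, $u'$, $\operatorname{sgn}(u'')|u''|^{p-1}$ and $(\operatorname{sgn}(u'')|u''|^{p-1})'$ are of class $C^1$ there and satisfy the equation (and the boundary conditions, where stated). *)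

theory Defs
  imports "HOL-Analysis.Analysis"
begin

definition sgn_pow :: "real \<Rightarrow> real \<Rightarrow> real" where
  "sgn_pow r x = sgn x * \<bar>x\<bar> powr (r - 1)"

text \<open>
  The derivative relative to \<open>S\<close>: one-sided at the endpoints of a closed interval, so it does not
  depend on the values of the function outside \<open>S\<close>. It is only meaningful when \<open>S\<close> has no
  isolated points; it is used for nondegenerate intervals and for the whole line.
\<close>
definition deriv_on :: "real set \<Rightarrow> (real \<Rightarrow> real) \<Rightarrow> real \<Rightarrow> real" where
  "deriv_on S f t = vector_derivative f (at t within S)"

text \<open>
  The library's \<open>C1_differentiable_on\<close> requires two-sided derivatives also at the endpoints.
\<close>
definition C1_on :: "real set \<Rightarrow> (real \<Rightarrow> real) \<Rightarrow> bool" where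
  "C1_on S f \<longleftrightarrow> f differentiable_on S \<and> continuous_on S (deriv_on S f)"

definition is_solution_on ::
    "real set \<Rightarrow> real \<Rightarrow> real \<Rightarrow> real \<Rightarrow> (real \<Rightarrow> real) \<Rightarrow> bool" where
  "is_solution_on S p q lam u \<longleftrightarrow>
     (let u' = deriv_on S u;
          u'' = deriv_on S u';
          w = (\<lambda>t. sgn_pow p (u'' t));
          w' = deriv_on S w;
          w'' = deriv_on S w'
      in C1_on S u \<and> C1_on S u' \<and> C1_on S w \<and> C1_on S w' \<and>
         (\<forall>t\<in>S. w'' t = lam * sgn_pow q (u t)))"

end

theory Submission
  imports Defs
begin

text \<open>
  Put \<open>W = - sgn_pow p u''\<close>. Then \<open>(u, W)\<close> is a positive solution of \<open>u'' = - W powr r\<close>,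
  \<open>W'' = - lam * u powr s\<close> vanishing at both ends, with \<open>r = 1 / (p - 1)\<close> and \<open>s = q - 1\<close>, and so is its
  reflection \<open>(v, Z)\<close>. Conservation of \<open>u' W' + W powr (r + 1) / (r + 1) + lam * u powr (s + 1) / (s + 1)\<close>
  gives \<open>u'(0) W'(0) = v'(0) Z'(0)\<close>. If \<open>u'(0) > v'(0)\<close>, then \<open>W'(0) < Z'(0)\<close>; since \<open>(u - v)''\<close>
  has the sign of \<open>Z - W\<close> and \<open>(Z - W)''\<close> that of \<open>u - v\<close>, both differences then grow
  forever, contradicting \<open>u = v\<close> at the right end. So the initial data agree. Although the
  nonlinearities need not be Lipschitz at \<open>0\<close>, concavity keeps \<open>u\<close>, \<open>W\<close> above a multiple of \<open>t\<close>, which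
  is enough for uniqueness. The symmetric solution extends as an antiperiodic function.
\<close>

section \<open>Mean values on a closed interval and growth of cooperative systems\<close>

lemma mvt_within:
  fixes g g1 :: "real \<Rightarrow> real"
  assumes g: "\<And>t. t \<in> {0..T} \<Longrightarrow> (g has_real_derivative g1 t) (at t within {0..T})"
    and "0 \<le> a" "a < b" "b \<le> T"
  obtains c where "a < c" "c < b" "g b - g a = (b - a) * g1 c"
proof -
  have "continuous_on {0..T} g"
    using g DERIV_continuous_on by blast
  then have "continuous_on {a..b} g"
    by (rule continuous_on_subset) (use assms in auto)
  moreover have "(g has_real_derivative g1 c) (at c)" if "a < c" "c < b" for c
    using g[of c] that assms at_within_Icc_at[of 0 c T] by auto
  ultimately show ?thesis
    using mvt[of a b g "\<lambda>c x. g1 c * x"] \<open>a < b\<close> that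
    by (metis has_field_derivative_def mult.commute)
qed

text \<open>Until the first time \<open>\<tau>\<close> at which a slope \<open>d1\<close> or
  \<open>f1\<close> fails to be positive, both \<open>d\<close> and \<open>f\<close> are
  nonnegative. Hence so are \<open>A\<close> and \<open>B\<close>, and both slopes at
  \<open>\<tau>\<close> are still at least their positive initial values, a contradiction.\<close>

lemma cooperative_growth:
  fixes d f d1 f1 A B :: "real \<Rightarrow> real"
  assumes d: "\<And>t. t \<in> {0..T} \<Longrightarrow> (d has_real_derivative d1 t) (at t within {0..T})"
    and d1: "\<And>t. t \<in> {0..T} \<Longrightarrow> (d1 has_real_derivative A t) (at t within {0..T})"
    and f: "\<And>t. t \<in> {0..T} \<Longrightarrow> (f has_real_derivative f1 t) (at t within {0..T})"
    and f1: "\<And>t. t \<in> {0..T} \<Longrightarrow> (f1 has_real_derivative B t) (at t within {0..T})"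
    and "d 0 = 0" "f 0 = 0" "0 < d1 0" "0 < f1 0" "0 < T"
    and A: "\<And>t. t \<in> {0..T} \<Longrightarrow> 0 \<le> f t \<Longrightarrow> 0 \<le> A t"
    and B: "\<And>t. t \<in> {0..T} \<Longrightarrow> 0 \<le> d t \<Longrightarrow> 0 \<le> B t"
  shows "0 < d T"
proof -
  define S where "S = {t \<in> {0..T}. min (d1 t) (f1 t) \<le> 0}"
  have pos: "0 < d1 t \<and> 0 < f1 t" if "t \<in> {0..T}" for t
  proof (rule ccontr)
    assume "\<not> (0 < d1 t \<and> 0 < f1 t)"
    then have "S \<noteq> {}" using that by (auto simp: S_def min_def)
    have "continuous_on {0..T} (\<lambda>t. min (d1 t) (f1 t))"
      using d1 f1 by (intro continuous_on_min DERIV_continuous_on) blast+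
    then have "closed S"
      unfolding S_def by (intro continuous_on_closed_Collect_le continuous_on_const) auto
    then have "compact S"
      unfolding S_def by (intro compact_eq_bounded_closed[THEN iffD2])
        (auto intro: bounded_subset[OF bounded_closed_interval[of 0 T]])
    then obtain \<tau> where \<tau>: "\<tau> \<in> S" "\<And>s. s \<in> S \<Longrightarrow> \<tau> \<le> s"
      using \<open>S \<noteq> {}\<close> compact_attains_inf by metis
    have "0 < \<tau>" "\<tau> \<le> T"
      using \<tau>(1) assms by (auto simp: S_def order_less_le)
    have before: "0 < d1 s" "0 < f1 s" if "0 \<le> s" "s < \<tau>" for s
    proof -
      have "\<not> min (d1 s) (f1 s) \<le> 0"
        using \<tau>(2)[of s] that \<open>\<tau> \<le> T\<close> by (auto simp: S_def)
      then show "0 < d1 s" "0 < f1 s" by auto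
    qed
    have nonneg: "0 \<le> d s" "0 \<le> f s" if s: "0 < s" "s < \<tau>" for s
    proof -
      obtain c where "0 < c" "c < s" "d s - d 0 = (s - 0) * d1 c"
        using mvt_within[OF d, of 0 s] s \<open>\<tau> \<le> T\<close> by auto
      then show "0 \<le> d s" using before[of c] s assms by simp
      obtain c where "0 < c" "c < s" "f s - f 0 = (s - 0) * f1 c"
        using mvt_within[OF f, of 0 s] s \<open>\<tau> \<le> T\<close> by auto
      then show "0 \<le> f s" using before[of c] s assms by simp
    qed
    obtain c where "0 < c" "c < \<tau>" "d1 \<tau> - d1 0 = (\<tau> - 0) * A c"
      using mvt_within[OF d1, of 0 \<tau>] \<open>0 < \<tau>\<close> \<open>\<tau> \<le> T\<close> by auto
    moreover from this have "0 \<le> \<tau> * A c"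
      using A[of c] nonneg[of c] \<open>\<tau> \<le> T\<close> by (intro mult_nonneg_nonneg) auto
    ultimately have "d1 0 \<le> d1 \<tau>" by simp
    obtain c where "0 < c" "c < \<tau>" "f1 \<tau> - f1 0 = (\<tau> - 0) * B c"
      using mvt_within[OF f1, of 0 \<tau>] \<open>0 < \<tau>\<close> \<open>\<tau> \<le> T\<close> by auto
    moreover from this have "0 \<le> \<tau> * B c"
      using B[of c] nonneg[of c] \<open>\<tau> \<le> T\<close> by (intro mult_nonneg_nonneg) auto
    ultimately have "f1 0 \<le> f1 \<tau>" by simp
    then show False
      using \<tau>(1) \<open>d1 0 \<le> d1 \<tau>\<close> assms by (auto simp: S_def min_def split: if_splits)
  qed
  obtain c where "0 < c" "c < T" "d T - d 0 = (T - 0) * d1 c"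
    using mvt_within[OF d, of 0 T] \<open>0 < T\<close> by auto
  then show ?thesis using pos[of c] assms by simp
qed

section \<open>Uniqueness for a linear system singular at 0\<close>

text \<open>The bound on \<open>g1\<close> integrates to
  \<open>N * (exp (2 * K * t) - 1) / 2\<close>; the rate \<open>2 * K\<close>, twice the constant
  \<open>K\<close> in front, produces the factor 1/2 that makes the later estimate a contraction.
  The bound is asked only for positive \<open>t\<close> because it will come from a division by
  \<open>t\<close>.\<close>

lemma le_half_exp_if_deriv_le_exp:
  fixes g g1 :: "real \<Rightarrow> real"
  assumes g: "\<And>t. t \<in> {0..T} \<Longrightarrow> (g has_real_derivative g1 t) (at t within {0..T})"
    and "g 0 = 0" "0 \<le> N"
    and bd: "\<And>t. 0 < t \<Longrightarrow> t \<le> T \<Longrightarrow> g1 t \<le> K * N * exp (2 * K * t)"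
    and t: "t \<in> {0..T}"
  shows "g t \<le> N * exp (2 * K * t) / 2"
proof (cases "t = 0")
  case False
  have "((\<lambda>t. N * exp (2 * K * t) / 2 - g t) has_real_derivative (K * N * exp (2 * K * x) - g1 x))
          (at x within {0..T})" if "x \<in> {0..T}" for x
    by (rule derivative_eq_intros g[OF that] refl | simp)+
  from mvt_within[OF this, of 0 t] obtain c where c: "0 < c" "c < t"
    "(N * exp (2 * K * t) / 2 - g t) - (N * exp (2 * K * 0) / 2 - g 0) = (t - 0) * (K * N * exp (2 * K * c) - g1 c)"
    using t False by auto
  moreover have "0 \<le> (t - 0) * (K * N * exp (2 * K * c) - g1 c)"
    using bd[of c] c t by (intro mult_nonneg_nonneg) auto
  ultimately have "0 \<le> N * exp (2 * K * t) / 2 - g t - (N * exp (2 * K * 0) / 2 - g 0)" by simp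
  then show ?thesis using \<open>g 0 = 0\<close> \<open>0 \<le> N\<close> by (simp add: field_simps)
qed (use assms in auto)

text \<open>
  The factor \<open>1 / t\<close> in the bounds on \<open>A\<close> and \<open>B\<close> is absorbed by \<open>\<bar>f t\<bar> \<le> t * sup \<bar>f1\<bar>\<close>, so that
  \<open>d1\<close> and \<open>f1\<close> satisfy a regular system; the supremum of \<open>max \<bar>d1\<bar> \<bar>f1\<bar>\<close> weighted by \<open>exp (- 2 K t)\<close>
  is then at most half of itself.
\<close>
lemma singular_system_unique:
  fixes d f d1 f1 A B :: "real \<Rightarrow> real"
  assumes d: "\<And>t. t \<in> {0..T} \<Longrightarrow> (d has_real_derivative d1 t) (at t within {0..T})"
    and d1: "\<And>t. t \<in> {0..T} \<Longrightarrow> (d1 has_real_derivative A t) (at t within {0..T})"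
    and f: "\<And>t. t \<in> {0..T} \<Longrightarrow> (f has_real_derivative f1 t) (at t within {0..T})"
    and f1: "\<And>t. t \<in> {0..T} \<Longrightarrow> (f1 has_real_derivative B t) (at t within {0..T})"
    and "d 0 = 0" "f 0 = 0" "d1 0 = 0" "f1 0 = 0" "0 < T" "0 \<le> K"
    and A: "\<And>t. 0 < t \<Longrightarrow> t \<le> T \<Longrightarrow> t * \<bar>A t\<bar> \<le> K * \<bar>f t\<bar>"
    and B: "\<And>t. 0 < t \<Longrightarrow> t \<le> T \<Longrightarrow> t * \<bar>B t\<bar> \<le> K * \<bar>d t\<bar>"
    and t: "t \<in> {0..T}"
  shows "d t = 0"
proof -
  define h where "h s = max \<bar>d1 s\<bar> \<bar>f1 s\<bar> * exp (- (2 * K * s))" for s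
  have "continuous_on {0..T} d1" "continuous_on {0..T} f1"
    using d1 f1 DERIV_continuous_on by blast+
  then have "continuous_on {0..T} h"
    unfolding h_def by (intro continuous_intros)
  then obtain m where m: "m \<in> {0..T}" "\<And>s. s \<in> {0..T} \<Longrightarrow> h s \<le> h m"
    using continuous_attains_sup[of "{0..T}" h] \<open>0 < T\<close> by auto
  define N where "N = h m"
  have "0 \<le> N" unfolding N_def h_def by auto
  have h: "max \<bar>d1 s\<bar> \<bar>f1 s\<bar> \<le> N * exp (2 * K * s)" if "s \<in> {0..T}" for s
  proof -
    have "h s * exp (2 * K * s) \<le> N * exp (2 * K * s)"
      using m(2)[OF that] by (simp add: N_def)
    then show ?thesis by (simp add: h_def mult.assoc flip: exp_add)
  qed
  \<comment> \<open>Stated for an abstract slope \<open>a1\<close> driven by \<open>b\<close>, since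
    it is applied both to \<open>d1\<close> driven by \<open>f\<close> and to \<open>f1\<close>
    driven by \<open>d\<close>.\<close>
  have step: "\<bar>a1 s\<bar> \<le> N * exp (2 * K * s) / 2"
    if a1: "\<And>t. t \<in> {0..T} \<Longrightarrow> (a1 has_real_derivative C t) (at t within {0..T})"
      and b: "\<And>t. t \<in> {0..T} \<Longrightarrow> (b has_real_derivative b1 t) (at t within {0..T})"
      and "b 0 = 0" "a1 0 = 0" "s \<in> {0..T}"
      and C: "\<And>t. 0 < t \<Longrightarrow> t \<le> T \<Longrightarrow> t * \<bar>C t\<bar> \<le> K * \<bar>b t\<bar>"
      and b1: "\<And>t. t \<in> {0..T} \<Longrightarrow> \<bar>b1 t\<bar> \<le> N * exp (2 * K * t)"
    for a1 C b b1 s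
  proof -
    have bound: "\<bar>C x\<bar> \<le> K * N * exp (2 * K * x)" if x: "0 < x" "x \<le> T" for x
    proof -
      obtain c where c: "0 < c" "c < x" "b x - b 0 = (x - 0) * b1 c"
        using mvt_within[OF b, of 0 x] x by auto
      have "\<bar>b1 c\<bar> \<le> N * exp (2 * K * c)" using b1[of c] c x by auto
      also have "\<dots> \<le> N * exp (2 * K * x)"
        using c \<open>0 \<le> N\<close> \<open>0 \<le> K\<close> by (intro mult_left_mono) (auto intro: mult_left_mono)
      finally have "x * \<bar>b1 c\<bar> \<le> x * (N * exp (2 * K * x))" using x by simp
      then have "K * \<bar>b x\<bar> \<le> K * (x * (N * exp (2 * K * x)))"
        using c x \<open>b 0 = 0\<close> \<open>0 \<le> K\<close> by (intro mult_left_mono) (auto simp: abs_mult)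
      with C[OF x] have "x * \<bar>C x\<bar> \<le> x * (K * N * exp (2 * K * x))" by (simp add: algebra_simps)
      then show ?thesis using x by simp
    qed
    have "a1 s \<le> N * exp (2 * K * s) / 2"
      by (rule le_half_exp_if_deriv_le_exp[OF a1]) (use that \<open>0 \<le> N\<close> bound in \<open>auto simp: abs_le_iff\<close>)
    moreover have "- a1 s \<le> N * exp (2 * K * s) / 2"
      by (rule le_half_exp_if_deriv_le_exp[OF DERIV_minus[OF a1]])
        (use that \<open>0 \<le> N\<close> bound in \<open>auto simp: abs_le_iff\<close>)
    ultimately show ?thesis by (simp add: abs_le_iff)
  qed
  have "\<bar>d1 m\<bar> \<le> N * exp (2 * K * m) / 2"
    by (rule step[OF d1 f]) (use assms m h in auto)
  moreover have "\<bar>f1 m\<bar> \<le> N * exp (2 * K * m) / 2"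
    by (rule step[OF f1 d]) (use assms m h in auto)
  ultimately have "max \<bar>d1 m\<bar> \<bar>f1 m\<bar> \<le> N * exp (2 * K * m) / 2" by simp
  then have "max \<bar>d1 m\<bar> \<bar>f1 m\<bar> * exp (- (2 * K * m)) \<le> N * exp (2 * K * m) / 2 * exp (- (2 * K * m))"
    by (intro mult_right_mono) auto
  then have "N \<le> N * exp (2 * K * m) / 2 * exp (- (2 * K * m))"
    by (simp only: N_def h_def)
  also have "\<dots> = N / 2" by (simp add: exp_minus)
  finally have "N = 0" using \<open>0 \<le> N\<close> by simp
  then have d1_zero: "d1 s = 0" if "s \<in> {0..T}" for s using h[OF that] by auto
  show ?thesis
  proof (cases "t = 0")
    case False
    obtain c where "0 < c" "c < t" "d t - d 0 = (t - 0) * d1 c"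
      using mvt_within[OF d, of 0 t] t False by auto
    then show ?thesis using d1_zero[of c] t assms by simp
  qed (use assms in auto)
qed

section \<open>Concave functions and differences of powers\<close>

text \<open>All three claims follow from \<open>g1\<close> being strictly decreasing, by comparing
  mean-value slopes on adjacent intervals. The chord claim is the division-free form of
  \<open>g x / x \<le> g t / t\<close>. The sign of \<open>g2\<close> is assumed only inside the
  interval, because the second derivatives in the application vanish at the ends.\<close>

lemma concave_bounds:
  fixes g g1 g2 :: "real \<Rightarrow> real"
  assumes g: "\<And>t. t \<in> {0..T} \<Longrightarrow> (g has_real_derivative g1 t) (at t within {0..T})"
    and g1: "\<And>t. t \<in> {0..T} \<Longrightarrow> (g1 has_real_derivative g2 t) (at t within {0..T})"
    and neg: "\<And>t. 0 < t \<Longrightarrow> t < T \<Longrightarrow> g2 t < 0"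
    and "g 0 = 0" "g T = 0" "0 < T"
  shows concave_pos: "0 < t \<Longrightarrow> t < T \<Longrightarrow> 0 < g t"
    and concave_deriv_pos: "0 < g1 0"
    and concave_chord: "0 < t \<Longrightarrow> t \<le> x \<Longrightarrow> x \<le> T \<Longrightarrow> t * g x \<le> x * g t"
proof -
  have anti: "g1 b < g1 a" if ab: "0 \<le> a" "a < b" "b \<le> T" for a b
  proof -
    obtain c where c: "a < c" "c < b" "g1 b - g1 a = (b - a) * g2 c"
      using mvt_within[OF g1 ab] by blast
    then have "(b - a) * g2 c < 0" using neg[of c] ab by (intro mult_pos_neg) auto
    then show ?thesis using c by auto
  qed
  have pos: "0 < g t" if t: "0 < t" "t < T" for t
  proof -
    obtain c where c: "0 < c" "c < t" "g t - g 0 = (t - 0) * g1 c"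
      using mvt_within[OF g, of 0 t] t by auto
    obtain e where e: "t < e" "e < T" "g T - g t = (T - t) * g1 e"
      using mvt_within[OF g, of t T] t by auto
    show ?thesis
    proof (rule ccontr)
      assume "\<not> 0 < g t"
      then have "t * g1 c \<le> 0" "0 \<le> (T - t) * g1 e"
        using c e \<open>g 0 = 0\<close> \<open>g T = 0\<close> by auto
      then have "g1 c \<le> 0" "0 \<le> g1 e"
        using t by (auto simp: mult_le_0_iff zero_le_mult_iff)
      then show False using anti[of c e] c e by auto
    qed
  qed
  then show "0 < t \<Longrightarrow> t < T \<Longrightarrow> 0 < g t" .
  obtain c where c: "0 < c" "c < T/2" "g (T/2) - g 0 = (T/2 - 0) * g1 c"
    using mvt_within[OF g, of 0 "T/2"] \<open>0 < T\<close> by auto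
  with pos[of "T/2"] \<open>0 < T\<close> \<open>g 0 = 0\<close> have "0 < T / 2 * g1 c" by simp
  then have "0 < g1 c" using \<open>0 < T\<close> by (simp add: zero_less_mult_iff)
  then show "0 < g1 0" using anti[of 0 c] c by auto
  show "t * g x \<le> x * g t" if t: "0 < t" "t \<le> x" "x \<le> T"
  proof (cases "t = x")
    case False
    obtain c where c: "0 < c" "c < t" "g t - g 0 = (t - 0) * g1 c"
      using mvt_within[OF g, of 0 t] t by auto
    obtain e where e: "t < e" "e < x" "g x - g t = (x - t) * g1 e"
      using mvt_within[OF g, of t x] t False by auto
    have "g1 e \<le> g1 c" using anti[of c e] c e t by auto
    then have "t * ((x - t) * g1 e) \<le> t * ((x - t) * g1 c)"
      using t by (intro mult_left_mono) auto
    moreover have gt: "g t = t * g1 c" using c assms by simp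
    moreover have gx: "g x = t * g1 c + (x - t) * g1 e" using e gt by simp
    ultimately show ?thesis unfolding gx gt by (simp add: algebra_simps)
  qed simp
qed

text \<open>The mean value theorem yields the factor \<open>r * c powr (r - 1)\<close> with
  \<open>c\<close> between \<open>x\<close> and \<open>y\<close>. Writing
  \<open>c powr (r - 1)\<close> as \<open>c powr r / c\<close> and using
  \<open>l \<le> c \<le> C\<close> covers exponents below and above 1 alike.\<close>

lemma powr_diff_bound:
  fixes r x y C l :: real
  assumes "0 < r" "0 < l" "l \<le> x" "l \<le> y" "x \<le> C" "y \<le> C"
  shows "l * \<bar>x powr r - y powr r\<bar> \<le> r * C powr r * \<bar>x - y\<bar>"
proof -
  have main: "l * \<bar>b powr r - a powr r\<bar> \<le> r * C powr r * \<bar>b - a\<bar>"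
    if ab: "l \<le> a" "a < b" "b \<le> C" for a b
  proof -
    have "((\<lambda>x. x powr r) has_real_derivative r * x powr (r - 1)) (at x)" if "a \<le> x" for x
      using that ab assms by (intro has_real_derivative_powr) auto
    from MVT2[OF \<open>a < b\<close> this] obtain c where c: "a < c" "c < b"
      "b powr r - a powr r = (b - a) * (r * c powr (r - 1))" by blast
    have "l * c powr (r - 1) \<le> c * c powr (r - 1)"
      using c ab by (intro mult_right_mono) auto
    also have "\<dots> = c powr r" using c ab assms by (simp add: powr_diff)
    also have "\<dots> \<le> C powr r" using c ab assms by (intro powr_mono2) auto
    finally have "(b - a) * r * (l * c powr (r - 1)) \<le> (b - a) * r * C powr r"
      using ab assms by (intro mult_left_mono) auto
    moreover have "0 \<le> (b - a) * (r * c powr (r - 1))" using ab assms by auto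
    ultimately show ?thesis using c(3) ab by (simp add: mult_ac)
  qed
  show ?thesis
    using main[of y x] main[of x y] assms
    by (cases x y rule: linorder_cases) (auto simp: abs_minus_commute)
qed


lemma powr_diff_bound_above_chord:
  fixes r x y C x0 m t :: real
  assumes "0 < r" "0 < t" "0 < m" "0 < x0"
    and "t * x0 \<le> m * x" "t * x0 \<le> m * y" "x \<le> C" "y \<le> C"
  shows "t * \<bar>x powr r - y powr r\<bar> \<le> r * C powr r * m / x0 * \<bar>x - y\<bar>"
proof -
  have "t * x0 / m * \<bar>x powr r - y powr r\<bar> \<le> r * C powr r * \<bar>x - y\<bar>"
    by (rule powr_diff_bound) (use assms in \<open>auto simp: field_simps\<close>)
  then show ?thesis using assms by (simp add: field_simps)
qed

section \<open>Symmetry of positive solutions of the second-order system\<close>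

lemma DERIV_reflect_within:
  fixes g g1 :: "real \<Rightarrow> real"
  assumes g: "\<And>t. t \<in> {0..T} \<Longrightarrow> (g has_real_derivative g1 t) (at t within {0..T})"
    and t: "t \<in> {0..T}"
  shows "((\<lambda>t. g (T - t)) has_real_derivative - g1 (T - t)) (at t within {0..T})"
proof -
  have "(\<lambda>t. T - t) ` {0..T} = {0..T}"
    using image_diff_atLeastAtMost[of T 0 T] by simp
  then have "(g has_real_derivative g1 (T - t)) (at (T - t) within (\<lambda>t. T - t) ` {0..T})"
    using g[of "T - t"] t by simp
  moreover have "((\<lambda>t. T - t) has_real_derivative - 1) (at t within {0..T})"
    by (auto intro!: derivative_eq_intros)
  ultimately show ?thesis
    using DERIV_image_chain[of g "g1 (T - t)" "\<lambda>t. T - t" t "{0..T}" "- 1"] by (simp add: o_def)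
qed

text \<open>Taking the differences in opposite orders, \<open>u - v\<close> and
  \<open>z - w\<close>, cancels the minus signs of the system: by monotonicity of powers each
  difference, when nonnegative, makes the second derivative of the other nonnegative. Then
  \<open>cooperative_growth\<close> separates \<open>u\<close> from \<open>v\<close> at
  \<open>T\<close>.\<close>

lemma positive_system_no_crossing:
  fixes u u1 w w1 v v1 z z1 :: "real \<Rightarrow> real"
  assumes u: "\<And>t. t \<in> {0..T} \<Longrightarrow> (u has_real_derivative u1 t) (at t within {0..T})"
    and u1: "\<And>t. t \<in> {0..T} \<Longrightarrow> (u1 has_real_derivative - (w t powr r)) (at t within {0..T})"
    and w: "\<And>t. t \<in> {0..T} \<Longrightarrow> (w has_real_derivative w1 t) (at t within {0..T})"
    and w1: "\<And>t. t \<in> {0..T} \<Longrightarrow> (w1 has_real_derivative - (lam * u t powr s)) (at t within {0..T})"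
    and v: "\<And>t. t \<in> {0..T} \<Longrightarrow> (v has_real_derivative v1 t) (at t within {0..T})"
    and v1: "\<And>t. t \<in> {0..T} \<Longrightarrow> (v1 has_real_derivative - (z t powr r)) (at t within {0..T})"
    and z: "\<And>t. t \<in> {0..T} \<Longrightarrow> (z has_real_derivative z1 t) (at t within {0..T})"
    and z1: "\<And>t. t \<in> {0..T} \<Longrightarrow> (z1 has_real_derivative - (lam * v t powr s)) (at t within {0..T})"
    and nonneg: "\<And>t. t \<in> {0..T} \<Longrightarrow> 0 \<le> w t" "\<And>t. t \<in> {0..T} \<Longrightarrow> 0 \<le> v t"
    and "0 < r" "0 < s" "0 < lam" "0 < T"
    and "u 0 = v 0" "w 0 = z 0" "u T = v T" "v1 0 < u1 0" "w1 0 < z1 0"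
  shows False
proof -
  have "0 < u T - v T"
  proof (rule cooperative_growth[of T "\<lambda>t. u t - v t" "\<lambda>t. u1 t - v1 t" _ "\<lambda>t. z t - w t" "\<lambda>t. z1 t - w1 t"])
    show "0 \<le> - (w t powr r) - - (z t powr r)" if "t \<in> {0..T}" "0 \<le> z t - w t" for t
      using nonneg that assms by (simp add: powr_mono2)
    show "0 \<le> - (lam * v t powr s) - - (lam * u t powr s)" if "t \<in> {0..T}" "0 \<le> u t - v t" for t
      using nonneg that assms by (simp add: powr_mono2)
  qed (rule DERIV_diff u u1 v v1 w w1 z z1 | simp add: \<open>0 < T\<close> \<open>u 0 = v 0\<close> \<open>w 0 = z 0\<close>
      \<open>v1 0 < u1 0\<close> \<open>w1 0 < z1 0\<close>)+
  then show False using \<open>u T = v T\<close> by simp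
qed

lemma positive_system_symmetric:
  fixes u u1 w w1 :: "real \<Rightarrow> real"
  assumes u: "\<And>t. t \<in> {0..T} \<Longrightarrow> (u has_real_derivative u1 t) (at t within {0..T})"
    and u1: "\<And>t. t \<in> {0..T} \<Longrightarrow> (u1 has_real_derivative - (w t powr r)) (at t within {0..T})"
    and w: "\<And>t. t \<in> {0..T} \<Longrightarrow> (w has_real_derivative w1 t) (at t within {0..T})"
    and w1: "\<And>t. t \<in> {0..T} \<Longrightarrow> (w1 has_real_derivative - (lam * u t powr s)) (at t within {0..T})"
    and pos: "\<And>t. 0 < t \<Longrightarrow> t < T \<Longrightarrow> 0 < u t" "\<And>t. 0 < t \<Longrightarrow> t < T \<Longrightarrow> 0 < w t"
    and ends: "u 0 = 0" "u T = 0" "w 0 = 0" "w T = 0"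
    and par: "0 < r" "0 < s" "0 < lam" "0 < T"
    and t: "t \<in> {0..T}"
  shows "u t = u (T - t)"
proof -
  \<comment> \<open>Two differentiations reverse the sign twice, so the reflected pair solves the
    same system.\<close>
  define v v1 z z1 where "v t = u (T - t)" and "v1 t = - u1 (T - t)"
    and "z t = w (T - t)" and "z1 t = - w1 (T - t)" for t
  have v: "(v has_real_derivative v1 t) (at t within {0..T})"
    and z: "(z has_real_derivative z1 t) (at t within {0..T})"
    and v1: "(v1 has_real_derivative - (z t powr r)) (at t within {0..T})"
    and z1: "(z1 has_real_derivative - (lam * v t powr s)) (at t within {0..T})"
    if "t \<in> {0..T}" for t
    using DERIV_reflect_within[OF u that] DERIV_reflect_within[OF w that]
      DERIV_minus[OF DERIV_reflect_within[OF u1 that]]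
      DERIV_minus[OF DERIV_reflect_within[OF w1 that]]
    unfolding v_def v1_def z_def z1_def by simp_all
  have nonneg: "0 \<le> u t" "0 \<le> w t" "0 \<le> v t" "0 \<le> z t" if "t \<in> {0..T}" for t
    using that pos[of t] pos[of "T - t"] ends unfolding v_def z_def
    by (cases "t = 0"; cases "t = T"; force)+
  have neg: "- (w t powr r) < 0" "- (lam * u t powr s) < 0"
    "- (z t powr r) < 0" "- (lam * v t powr s) < 0" if "0 < t" "t < T" for t
    using pos[of t] pos[of "T - t"] that par unfolding v_def z_def by auto
  have vz_ends: "v 0 = 0" "v T = 0" "z 0 = 0" "z T = 0"
    using ends by (auto simp: v_def z_def)
  have slopes: "0 < u1 0" "0 < w1 0" "0 < v1 0" "0 < z1 0"
    by (rule concave_deriv_pos[OF u u1 neg(1)] concave_deriv_pos[OF w w1 neg(2)]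
      concave_deriv_pos[OF v v1 neg(3)] concave_deriv_pos[OF z z1 neg(4)];
      simp add: ends vz_ends par)+
  \<comment> \<open>\<open>E\<close> is the Hamiltonian of the system. Its power terms vanish at
    both ends, leaving the products of slopes; the two signs from the reflection at \<open>T\<close>
    cancel. The derivative of \<open>E\<close> is computed only inside, where the bases of the
    powers are positive, and continuity reaches the ends.\<close>
  have energy: "u1 0 * w1 0 = v1 0 * z1 0"
  proof -
    define E where "E t = u1 t * w1 t + w t powr (r + 1) / (r + 1)
        + lam * (u t powr (s + 1) / (s + 1))" for t
    have c: "continuous_on {0..T} u" "continuous_on {0..T} u1"
      "continuous_on {0..T} w" "continuous_on {0..T} w1"
      by (rule DERIV_continuous_on, erule u u1 w w1)+
    have "0 < r + 1" "0 < s + 1" using par by auto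
    then have "continuous_on {0..T} (\<lambda>t. w t powr (r + 1))"
      "continuous_on {0..T} (\<lambda>t. u t powr (s + 1))"
      by (auto intro!: continuous_on_powr'[OF c(3) continuous_on_const]
          continuous_on_powr'[OF c(1) continuous_on_const] nonneg)
    then have "continuous_on {0..T} E"
      unfolding E_def using par
      by (intro continuous_on_add continuous_on_mult continuous_on_divide continuous_on_const c) auto
    moreover have "(E has_real_derivative 0) (at x)" if x: "0 < x" "x < T" for x
    proof -
      have "at x within {0..T} = at x" using x by (intro at_within_Icc_at)
      then have D: "(u has_real_derivative u1 x) (at x)" "(w has_real_derivative w1 x) (at x)"
        "(u1 has_real_derivative - (w x powr r)) (at x)"
        "(w1 has_real_derivative - (lam * u x powr s)) (at x)"
        using u[of x] w[of x] u1[of x] w1[of x] x by auto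
      have P: "((\<lambda>t. w t powr (r + 1) / (r + 1)) has_real_derivative w x powr r * w1 x) (at x)"
        "((\<lambda>t. u t powr (s + 1) / (s + 1)) has_real_derivative u x powr s * u1 x) (at x)"
        using DERIV_cdivide[OF DERIV_fun_powr[OF D(2) pos(2)[OF x], of "r + 1"], of "r + 1"]
          DERIV_cdivide[OF DERIV_fun_powr[OF D(1) pos(1)[OF x], of "s + 1"], of "s + 1"] par
        by auto
      have "(E has_real_derivative - (w x powr r) * w1 x + - (lam * u x powr s) * u1 x
          + w x powr r * w1 x + lam * (u x powr s * u1 x)) (at x)"
        unfolding E_def by (intro DERIV_add DERIV_mult DERIV_cmult D P)
      then show ?thesis by simp
    qed
    ultimately have "E T = E 0" using DERIV_isconst_end[of 0 T E] par by blast
    then show ?thesis using ends par by (simp add: E_def v1_def z1_def)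
  qed
  \<comment> \<open>With equal products, unequal slopes of \<open>u\<close> and \<open>v\<close>
    force the opposite order for \<open>w\<close> and \<open>z\<close>, which is the configuration
    excluded by \<open>positive_system_no_crossing\<close>.\<close>
  have swap: "y' < y" if "x * y = x' * y'" "x < x'" "0 < x" "0 < y" for x y x' y' :: real
  proof (rule ccontr)
    assume "\<not> y' < y"
    then show False
      using mult_left_mono[of y y' x] mult_strict_right_mono[of x x' y'] that by simp
  qed
  have "u1 0 = v1 0"
  proof (cases "u1 0" "v1 0" rule: linorder_cases)
    case less
    then have "z1 0 < w1 0"
      using swap[OF energy] slopes by simp
    then have False
      by (intro positive_system_no_crossing[OF v v1 z z1 u u1 w w1])
        (simp_all add: nonneg par ends vz_ends less)
    then show ?thesis ..
  next
    case greater
    then have "w1 0 < z1 0"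
      using swap[OF energy[symmetric]] slopes by simp
    then have False
      by (intro positive_system_no_crossing[OF u u1 w w1 v v1 z z1])
        (simp_all add: nonneg par ends vz_ends greater)
    then show ?thesis ..
  qed
  with energy slopes have "w1 0 = z1 0" by simp
  \<comment> \<open>Uniqueness is run only up to the midpoint: there the pair meets its reflection,
    so both chords from 0 end at the same height, whereas near \<open>T\<close> the functions tend
    to 0 and no lower bound by a multiple of \<open>t\<close> survives.\<close>
  define m where "m = T / 2"
  have m: "0 < m" "m < T" "v m = u m" "z m = w m" using par by (auto simp: m_def v_def z_def)
  have half: "u t = v t" if t: "t \<in> {0..m}" for t
  proof -
    have "continuous_on {0..T} u" "continuous_on {0..T} w"
      by (rule DERIV_continuous_on, erule u w)+
    then obtain a b where ab: "\<And>t. t \<in> {0..T} \<Longrightarrow> u t \<le> u a" "\<And>t. t \<in> {0..T} \<Longrightarrow> w t \<le> w b"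
      using continuous_attains_sup[of "{0..T}" u] continuous_attains_sup[of "{0..T}" w] par
      by (auto simp: Ball_def)
    \<comment> \<open>The sum of the two Lipschitz constants, so that one \<open>K\<close> serves
      both equations; the maxima \<open>u a\<close> and \<open>w b\<close> bound the reflected
      functions too.\<close>
    define K where "K = r * w b powr r * m / w m + lam * (s * u a powr s * m / u m)"
    have um: "0 < u m" "0 < w m" using pos m by auto
    have parts: "0 \<le> r * w b powr r * m / w m" "0 \<le> lam * (s * u a powr s * m / u m)"
      using par m um by auto
    have sub: "{0..m} \<subseteq> {0..T}" using m by auto
    have "(\<lambda>t. u t - v t) t = 0"
    proof (rule singular_system_unique[of m "\<lambda>t. u t - v t" "\<lambda>t. u1 t - v1 t" _ "\<lambda>t. w t - z t" "\<lambda>t. w1 t - z1 t" _ K])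
      fix t assume "t \<in> {0..m}"
      then have tT: "t \<in> {0..T}" using sub by auto
      show "((\<lambda>t. u t - v t) has_real_derivative u1 t - v1 t) (at t within {0..m})"
        "((\<lambda>t. u1 t - v1 t) has_real_derivative - (w t powr r) - - (z t powr r)) (at t within {0..m})"
        "((\<lambda>t. w t - z t) has_real_derivative w1 t - z1 t) (at t within {0..m})"
        "((\<lambda>t. w1 t - z1 t) has_real_derivative - (lam * u t powr s) - - (lam * v t powr s)) (at t within {0..m})"
        by (rule DERIV_diff; rule DERIV_subset[OF _ sub];
            rule u[OF tT] v[OF tT] u1[OF tT] v1[OF tT] w[OF tT] z[OF tT] w1[OF tT] z1[OF tT])+
    next
      fix t assume t: "0 < t" "t \<le> m"
      have bd: "u t \<le> u a" "v t \<le> u a" "w t \<le> w b" "z t \<le> w b"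
        using ab[of t] ab[of "T - t"] t m by (auto simp: v_def z_def)
      have ch: "t * u m \<le> m * u t" "t * u m \<le> m * v t" "t * w m \<le> m * w t" "t * w m \<le> m * z t"
        by (rule concave_chord[OF u u1 neg(1)] concave_chord[OF w w1 neg(2)]
            concave_chord[OF v v1 neg(3), of t m, unfolded m(3)]
            concave_chord[OF z z1 neg(4), of t m, unfolded m(4)];
            use ends vz_ends par t m in simp)+
      have "t * \<bar>w t powr r - z t powr r\<bar> \<le> r * w b powr r * m / w m * \<bar>w t - z t\<bar>"
        by (rule powr_diff_bound_above_chord) (use par t m um bd ch in auto)
      also have "\<dots> \<le> K * \<bar>w t - z t\<bar>"
        unfolding K_def by (intro mult_right_mono) (use parts in auto)
      finally show "t * \<bar>- (w t powr r) - - (z t powr r)\<bar> \<le> K * \<bar>w t - z t\<bar>"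
        by (simp add: abs_minus_commute)
      have "t * \<bar>u t powr s - v t powr s\<bar> \<le> s * u a powr s * m / u m * \<bar>u t - v t\<bar>"
        by (rule powr_diff_bound_above_chord) (use par t m um bd ch in auto)
      then have "lam * (t * \<bar>u t powr s - v t powr s\<bar>) \<le> lam * (s * u a powr s * m / u m * \<bar>u t - v t\<bar>)"
        using par by (intro mult_left_mono) auto
      also have "\<dots> = lam * (s * u a powr s * m / u m) * \<bar>u t - v t\<bar>" by simp
      also have "\<dots> \<le> K * \<bar>u t - v t\<bar>"
        unfolding K_def by (intro mult_right_mono) (use parts in auto)
      also have "lam * (t * \<bar>u t powr s - v t powr s\<bar>) = t * \<bar>lam * (v t powr s - u t powr s)\<bar>"
        using par by (simp add: abs_mult abs_minus_commute)
      finally show "t * \<bar>- (lam * u t powr s) - - (lam * v t powr s)\<bar> \<le> K * \<bar>u t - v t\<bar>"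
        by (simp add: algebra_simps)
    qed (use t ends vz_ends m parts \<open>u1 0 = v1 0\<close> \<open>w1 0 = z1 0\<close> in \<open>auto simp: K_def\<close>)
    then show ?thesis by simp
  qed
  show ?thesis
  proof (cases "t \<le> m")
    case True
    then show ?thesis using half[of t] t by (simp add: v_def)
  next
    case False
    then have "u (T - t) = v (T - t)" using t by (intro half) (simp add: m_def)
    then show ?thesis by (simp add: v_def)
  qed
qed

section \<open>Antiperiodic extension to the real line\<close>

text \<open>For a symmetric function vanishing at the ends this is its odd
  \<open>2 * T\<close>-periodic extension. Unlike a rule by odd and even reflections, the same
  formula applies to the function and to all its derivatives.\<close>

definition antiperiodic_ext :: "real \<Rightarrow> (real \<Rightarrow> real) \<Rightarrow> real \<Rightarrow> real" where
  "antiperiodic_ext T f t = (if even \<lfloor>t / T\<rfloor> then 1 else - 1) * f (t - of_int \<lfloor>t / T\<rfloor> * T)"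

lemma antiperiodic_ext_shift:
  assumes "0 < T"
  shows "antiperiodic_ext T f (t + of_int k * T) = (if even k then 1 else - 1) * antiperiodic_ext T f t"
proof -
  have "(t + of_int k * T) / T = t / T + of_int k" using assms by (simp add: field_simps)
  then have "\<lfloor>(t + of_int k * T) / T\<rfloor> = \<lfloor>t / T\<rfloor> + k" by simp
  then show ?thesis by (simp add: antiperiodic_ext_def algebra_simps)
qed

lemma antiperiodic_ext_base:
  assumes "0 \<le> t" "t < T"
  shows "antiperiodic_ext T f t = f t"
proof -
  have "\<lfloor>t / T\<rfloor> = 0" using assms by (simp add: floor_eq_iff)
  then show ?thesis by (simp add: antiperiodic_ext_def)
qed

lemma antiperiodic_ext_left:
  assumes "- T \<le> t" "t < 0"
  shows "antiperiodic_ext T f t = - f (t + T)"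
proof -
  have "\<lfloor>t / T\<rfloor> = - 1" using assms by (simp add: floor_eq_iff field_simps)
  then show ?thesis by (simp add: antiperiodic_ext_def)
qed

lemma antiperiodic_ext_closed:
  assumes "0 \<le> t" "t \<le> T" "0 < T" "f T = - f 0"
  shows "antiperiodic_ext T f t = f t"
  using antiperiodic_ext_base[of t T f] antiperiodic_ext_base[of 0 T f]
    antiperiodic_ext_shift[of T f 0 1] assms by (cases "t = T") auto

lemma odd_antiperiodic_ext:
  assumes "\<And>x. h (- x) = - h x"
  shows "h (antiperiodic_ext T f t) = antiperiodic_ext T (\<lambda>t. h (f t)) t"
  using assms by (simp add: antiperiodic_ext_def)

text \<open>Reduces a claim at \<open>t\<close> to the point \<open>x\<close> of the base interval,
  the extension being a translate up to the sign \<open>c\<close>. Since \<open>c\<close> does not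
  depend on \<open>f\<close>, a function and its derivative, or the two sides of an equation, are
  moved together.\<close>

lemma antiperiodic_ext_decompose:
  assumes "0 < T"
  obtains c x where "0 \<le> x" "x < T"
    "\<And>f. antiperiodic_ext T f t = c * antiperiodic_ext T f x"
    "\<And>f. antiperiodic_ext T f = (\<lambda>y. c * antiperiodic_ext T f (y - (t - x)))"
proof -
  define k where "k = \<lfloor>t / T\<rfloor>"
  have k: "of_int k \<le> t / T" "t / T < of_int k + 1" unfolding k_def by linarith+
  show ?thesis
  proof (rule that[of "t - of_int k * T" "if even k then 1 else - 1"])
    show "0 \<le> t - of_int k * T" "t - of_int k * T < T" using k assms by (auto simp: field_simps)
    show "antiperiodic_ext T f t = (if even k then 1 else - 1) * antiperiodic_ext T f (t - of_int k * T)" for f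
      using antiperiodic_ext_shift[OF assms, of f "t - of_int k * T" k] by simp
    show "antiperiodic_ext T f = (\<lambda>y. (if even k then 1 else - 1) *
        antiperiodic_ext T f (y - (t - (t - of_int k * T))))" for f
    proof
      fix y
      show "antiperiodic_ext T f y = (if even k then 1 else - 1) *
          antiperiodic_ext T f (y - (t - (t - of_int k * T)))"
        using antiperiodic_ext_shift[OF assms, of f "y - of_int k * T" k] by simp
    qed
  qed
qed

text \<open>After translation the only gluing point is 0, where the limit from the right is
  \<open>g 0\<close> and the limit from the left is \<open>- g T\<close>.\<close>

lemma continuous_antiperiodic_ext:
  assumes "0 < T" and g: "continuous_on {0..T} g" "g T = - g 0"
  shows "continuous_on UNIV (antiperiodic_ext T g)"
proof -
  have base: "isCont (antiperiodic_ext T g) x" if x: "0 \<le> x" "x < T" for x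
  proof (cases "x = 0")
    case False
    have "continuous_on {0<..<T} (antiperiodic_ext T g) \<longleftrightarrow> continuous_on {0<..<T} g"
      by (intro continuous_on_cong) (auto simp: antiperiodic_ext_base)
    then have "continuous_on {0<..<T} (antiperiodic_ext T g)"
      using g by (auto elim: continuous_on_subset)
    then show ?thesis using x False by (simp add: continuous_on_eq_continuous_at)
  next
    case True
    have "(g \<longlongrightarrow> g 0) (at 0 within {0..T})"
      using g \<open>0 < T\<close> by (auto simp: continuous_on_def)
    then have "(g \<longlongrightarrow> g 0) (at_right 0)"
      using at_within_Icc_at_right[OF \<open>0 < T\<close>] by simp
    then have R: "(antiperiodic_ext T g \<longlongrightarrow> g 0) (at_right 0)"
      by (rule Lim_transform_eventually)
        (use assms in \<open>auto simp: eventually_at_right[of _ T] antiperiodic_ext_base intro!: exI[of _ T]\<close>)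
    have "continuous_on {- T..0} (\<lambda>t. - g (t + T))"
      by (intro continuous_intros continuous_on_compose2[OF g(1)]) auto
    then have "((\<lambda>t. - g (t + T)) \<longlongrightarrow> - g (0 + T)) (at 0 within {- T..0})"
      using \<open>0 < T\<close> unfolding continuous_on_def by (intro bspec[of _ _ 0]) auto
    then have "((\<lambda>t. - g (t + T)) \<longlongrightarrow> - g (0 + T)) (at_left 0)"
      using at_within_Icc_at_left[of "- T" 0] \<open>0 < T\<close> by simp
    then have L: "(antiperiodic_ext T g \<longlongrightarrow> - g (0 + T)) (at_left 0)"
      by (rule Lim_transform_eventually)
        (use \<open>0 < T\<close> in \<open>auto simp: eventually_at_left[of "- T"] antiperiodic_ext_left intro!: exI[of _ "- T"]\<close>)
    have "- g (0 + T) = g 0" using g(2) by simp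
    with L have "(antiperiodic_ext T g \<longlongrightarrow> g 0) (at_left 0)" by metis
    from filterlim_split_at[OF this R] show ?thesis
      using True \<open>0 < T\<close> by (simp add: isCont_def antiperiodic_ext_base)
  qed
  have "isCont (antiperiodic_ext T g) t" for t
  proof -
    obtain c x where cx: "0 \<le> x" "x < T"
      "\<And>f. antiperiodic_ext T f = (\<lambda>y. c * antiperiodic_ext T f (y - (t - x)))"
      using antiperiodic_ext_decompose[OF \<open>0 < T\<close>, of t] by metis
    have "isCont (\<lambda>y. antiperiodic_ext T g (y - (t - x))) t"
      by (rule isCont_o2[where f = "\<lambda>y. y - (t - x)"]) (simp_all add: base[OF cx(1,2)])
    then have "isCont (\<lambda>y. c * antiperiodic_ext T g (y - (t - x))) t"
      by (rule isCont_mult[OF continuous_const])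
    then show ?thesis using cx(3)[of g] by simp
  qed
  then show ?thesis by (simp add: continuous_at_imp_continuous_on)
qed

lemma DERIV_antiperiodic_ext:
  assumes "0 < T"
    and f: "\<And>t. t \<in> {0..T} \<Longrightarrow> (f has_real_derivative g t) (at t within {0..T})"
    and fT: "f T = - f 0" and gT: "g T = - g 0"
  shows "(antiperiodic_ext T f has_real_derivative antiperiodic_ext T g t) (at t)"
proof -
  have base: "(antiperiodic_ext T f has_real_derivative g x) (at x)" if x: "0 \<le> x" "x < T" for x
  proof (cases "x = 0")
    case False
    then have "(f has_real_derivative g x) (at x)"
      using f[of x] x at_within_Icc_at[of 0 x T] by auto
    then show ?thesis
      by (rule has_field_derivative_transform_within_open[of _ _ _ "{0<..<T}"])
        (use x False in \<open>auto simp: antiperiodic_ext_base\<close>)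
  next
    case True
    let ?q = "\<lambda>y. (antiperiodic_ext T f y - antiperiodic_ext T f 0) / (y - 0)"
    have "((\<lambda>y. (f y - f 0) / (y - 0)) \<longlongrightarrow> g 0) (at_right 0)"
      using f[of 0] assms at_within_Icc_at_right[of 0 T] by (simp add: has_field_derivative_iff)
    then have R: "(?q \<longlongrightarrow> g 0) (at_right 0)"
      by (rule Lim_transform_eventually)
        (use assms in \<open>auto simp: eventually_at_right[of _ T] antiperiodic_ext_base intro!: exI[of _ T]\<close>)
    \<comment> \<open>Left of 0 the extension is minus the translate of \<open>f\<close> from the
      left of \<open>T\<close>. By \<open>fT\<close> the two difference quotients agree up to sign,
      and \<open>gT\<close> matches the slopes.\<close>
    have "(f has_real_derivative g T) (at_left T)"
      using f[of T] assms at_within_Icc_at_left[of 0 T] by simp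
    then have "((\<lambda>y. (f y - f T) / (y - T)) \<longlongrightarrow> g T) (at_left T)"
      by (simp add: has_field_derivative_iff)
    moreover have "at_left T = filtermap (\<lambda>y. y + T) (at_left 0)"
      using filtermap_at_left_shift[of "- T" 0] by simp
    ultimately have "((\<lambda>y. (f (y + T) - f T) / (y + T - T)) \<longlongrightarrow> g T) (at_left 0)"
      by (simp add: filterlim_filtermap)
    from tendsto_minus[OF this]
    have "((\<lambda>y. - ((f (y + T) - f T) / y)) \<longlongrightarrow> g 0) (at_left 0)" using gT by simp
    then have L: "(?q \<longlongrightarrow> g 0) (at_left 0)"
      by (rule Lim_transform_eventually)
        (use \<open>0 < T\<close> fT in \<open>auto simp: eventually_at_left[of "- T"] antiperiodic_ext_left antiperiodic_ext_base
            divide_simps intro!: exI[of _ "- T"]\<close>)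
    show ?thesis using filterlim_split_at[OF L R] True by (simp add: has_field_derivative_iff)
  qed
  obtain c x where cx: "0 \<le> x" "x < T"
    "\<And>f. antiperiodic_ext T f t = c * antiperiodic_ext T f x"
    "\<And>f. antiperiodic_ext T f = (\<lambda>y. c * antiperiodic_ext T f (y - (t - x)))"
    using antiperiodic_ext_decompose[OF \<open>0 < T\<close>, of t] by metis
  have "((\<lambda>y. antiperiodic_ext T f (y - (t - x))) has_real_derivative g x * 1) (at t)"
    by (rule DERIV_chain2[where g = "\<lambda>y. y - (t - x)"])
      (use base[OF cx(1,2)] in \<open>auto intro!: derivative_eq_intros\<close>)
  then have "((\<lambda>y. c * antiperiodic_ext T f (y - (t - x))) has_real_derivative c * g x) (at t)"
    by (auto intro!: derivative_eq_intros)
  then show ?thesis using cx(3)[of g] cx(4)[of f] cx(1,2) by (simp add: antiperiodic_ext_base)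
qed

section \<open>Relative derivatives and signed powers\<close>

lemma deriv_on_eqI:
  assumes "(f has_real_derivative d) (at t within S)" "at t within S \<noteq> bot"
  shows "deriv_on S f t = d"
  unfolding deriv_on_def
  by (rule vector_derivative_within[OF assms(2)])
    (use assms in \<open>simp add: has_real_derivative_iff_has_vector_derivative\<close>)

lemma C1_on_DERIV:
  assumes "C1_on S f" "t \<in> S"
  shows "(f has_real_derivative deriv_on S f t) (at t within S)"
  using assms unfolding C1_on_def deriv_on_def differentiable_on_def
  by (auto simp: has_real_derivative_iff_has_vector_derivative vector_derivative_works)

lemma C1_on_UNIV_I:
  assumes "\<And>t. (f has_real_derivative g t) (at t)" "continuous_on UNIV g"
  shows "C1_on UNIV f" "deriv_on UNIV f = g"
proof -
  show "deriv_on UNIV f = g" using deriv_on_eqI[OF assms(1)] by auto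
  then show "C1_on UNIV f" using assms unfolding C1_on_def differentiable_on_def
    by (auto simp: real_differentiable_def)
qed

lemma sgn_pow_minus: "sgn_pow r (- x) = - sgn_pow r x"
  by (simp add: sgn_pow_def sgn_minus)

lemma sgn_pow_0 [simp]: "sgn_pow r 0 = 0"
  by (simp add: sgn_pow_def)

text \<open>The signed power keeps the sign of \<open>x\<close>, so \<open>x\<close> is nonpositive
  and the exponent \<open>p - 1\<close> is undone by its reciprocal. This solves for the second
  derivative in the first equation of the system.\<close>

lemma eq_if_minus_sgn_pow_nonneg:
  assumes "1 < p" "0 \<le> - sgn_pow p x"
  shows "x = - ((- sgn_pow p x) powr (1 / (p - 1)))"
proof (cases "x = 0")
  case False
  have "x < 0"
  proof (rule ccontr)
    assume "\<not> x < 0"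
    then have "0 < sgn_pow p x" using False by (simp add: sgn_pow_def)
    then show False using assms by simp
  qed
  then show ?thesis using assms by (simp add: sgn_pow_def powr_powr)
qed simp

section \<open>Reduction to the positive system and gluing\<close>

theorem theorem5p1:
  fixes p q t0 lam :: real and u :: "real \<Rightarrow> real"
  assumes "1 < p" and "1 < q" and "t0 > 0" and "lam > 0"
    and "is_solution_on {0..t0} p q lam u"
    and "u 0 = 0" and "u t0 = 0"
    and "deriv_on {0..t0} (deriv_on {0..t0} u) 0 = 0"
    and "deriv_on {0..t0} (deriv_on {0..t0} u) t0 = 0"
    and "\<forall>t\<in>{0<..<t0}. u t > 0"
  shows "(\<forall>t. 0 < t \<and> t < t0 / 2 \<longrightarrow> u t = u (t0 - t)) \<and>
    (\<exists>ustar :: real \<Rightarrow> real.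
        (\<forall>t\<in>{0..t0}. ustar t = u t) \<and>
        (\<forall>t. ustar (t + 2 * t0) = ustar t) \<and>
        C1_on UNIV ustar \<and>
        is_solution_on UNIV p q lam ustar)"
proof -
  let ?D = "deriv_on {0..t0}"
  \<comment> \<open>Here \<open>w\<close> keeps the sign of the original equation; the positive
    second component of the system is \<open>- w\<close>.\<close>
  define u1 u2 w w1 w2 where "u1 = ?D u" and "u2 = ?D u1" and "w = (\<lambda>t. sgn_pow p (u2 t))"
    and "w1 = ?D w" and "w2 = ?D w1"
  note defs = u1_def u2_def w_def w1_def w2_def
  have C1: "C1_on {0..t0} u" "C1_on {0..t0} u1" "C1_on {0..t0} w" "C1_on {0..t0} w1"
    and w2: "\<And>t. t \<in> {0..t0} \<Longrightarrow> w2 t = lam * sgn_pow q (u t)"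
    using \<open>is_solution_on {0..t0} p q lam u\<close> unfolding is_solution_on_def Let_def defs by auto
  have D: "(u has_real_derivative u1 t) (at t within {0..t0})"
    "(u1 has_real_derivative u2 t) (at t within {0..t0})"
    "(w has_real_derivative w1 t) (at t within {0..t0})"
    "(w1 has_real_derivative w2 t) (at t within {0..t0})" if "t \<in> {0..t0}" for t
    using C1[THEN C1_on_DERIV, OF that] unfolding u1_def[symmetric] u2_def[symmetric]
      w1_def[symmetric] w2_def[symmetric] by auto
  have cont: "continuous_on {0..t0} u1" "continuous_on {0..t0} u2"
    "continuous_on {0..t0} w1" "continuous_on {0..t0} w2"
    using C1 unfolding C1_on_def u1_def[symmetric] u2_def[symmetric]
      w1_def[symmetric] w2_def[symmetric] by auto
  have u2_ends: "u2 0 = 0" "u2 t0 = 0" using assms by (auto simp: u2_def u1_def)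
  then have w_ends: "w 0 = 0" "w t0 = 0" by (auto simp: w_def)
  have pos: "0 < u t" if "0 < t" "t < t0" for t using assms that by auto
  have w2_pos: "- w2 t < 0" if "0 < t" "t < t0" for t
    using pos[OF that] w2[of t] that \<open>lam > 0\<close> by (simp add: sgn_pow_def)
  \<comment> \<open>The equation makes \<open>- w\<close> strictly concave where \<open>u\<close> is
    positive, and it vanishes at both ends because the second derivative of \<open>u\<close>
    does.\<close>
  have w_neg: "0 < - w t" if "0 < t" "t < t0" for t
    by (rule concave_pos[OF DERIV_minus[OF D(3)] DERIV_minus[OF D(4)] w2_pos])
      (simp_all add: w_ends that \<open>t0 > 0\<close>)
  have u_nonneg: "0 \<le> u t" and w_nonpos: "0 \<le> - w t" if "t \<in> {0..t0}" for t
    using that pos[of t] w_neg[of t] \<open>u 0 = 0\<close> \<open>u t0 = 0\<close> w_ends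
    by (auto simp: order_le_less)
  have u2_eq: "u2 t = - ((- w t) powr (1 / (p - 1)))" if "t \<in> {0..t0}" for t
    using eq_if_minus_sgn_pow_nonneg[OF \<open>1 < p\<close>, of "u2 t"] w_nonpos[OF that] by (simp add: w_def)
  have w2_eq: "w2 t = lam * u t powr (q - 1)" if "t \<in> {0..t0}" for t
    using w2[OF that] u_nonneg[OF that] by (cases "u t = 0") (auto simp: sgn_pow_def)
  have D2: "(u1 has_real_derivative - ((- w t) powr (1 / (p - 1)))) (at t within {0..t0})"
    and D4: "((\<lambda>t. - w1 t) has_real_derivative - (lam * u t powr (q - 1))) (at t within {0..t0})"
    if "t \<in> {0..t0}" for t
    using D(2)[OF that] u2_eq[OF that] DERIV_minus[OF D(4)[OF that]] w2_eq[OF that] by simp_all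
  have sym: "u t = u (t0 - t)" if "t \<in> {0..t0}" for t
    by (rule positive_system_symmetric[of t0 u u1 "\<lambda>t. - w t" "1 / (p - 1)" "\<lambda>t. - w1 t" lam "q - 1",
          OF D(1) D2 DERIV_minus[OF D(3)] D4 pos w_neg])
      (use that assms(1-4,6,7) w_ends in simp_all)
  have nontriv: "at t within {0..t0} \<noteq> bot" if "t \<in> {0..t0}" for t
    using that assms by (simp add: trivial_limit_within)
  \<comment> \<open>Differentiation flips the parity under reflection, one-sided derivatives on the
    interval being unique. Applied with \<open>c = 1\<close> and \<open>c = - 1\<close> it passes
    the symmetry of \<open>u\<close> down to \<open>u1\<close>, \<open>u2\<close>, \<open>w\<close>
    and \<open>w1\<close>.\<close>
  have deriv_sym: "f1 t = - c * f1 (t0 - t)"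
    if f: "\<And>t. t \<in> {0..t0} \<Longrightarrow> (f has_real_derivative f1 t) (at t within {0..t0})"
      and fsym: "\<And>t. t \<in> {0..t0} \<Longrightarrow> f t = c * f (t0 - t)" and t: "t \<in> {0..t0}" for f f1 c t
  proof -
    have "((\<lambda>t. c * f (t0 - t)) has_real_derivative c * - f1 (t0 - t)) (at t within {0..t0})"
      by (rule DERIV_cmult[OF DERIV_reflect_within[OF f t]])
    then have "(f has_real_derivative c * - f1 (t0 - t)) (at t within {0..t0})"
      by (rule has_field_derivative_transform_within[OF _ zero_less_one t]) (rule fsym[symmetric])
    from deriv_on_eqI[OF this nontriv[OF t]] deriv_on_eqI[OF f[OF t] nontriv[OF t]]
    show ?thesis by simp
  qed
  have u_sym: "u t = 1 * u (t0 - t)" if "t \<in> {0..t0}" for t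
    using sym[OF that] by simp
  have u1_anti: "u1 t = - 1 * u1 (t0 - t)" if "t \<in> {0..t0}" for t
    using deriv_sym[OF D(1) u_sym that] .
  have "u2 t = u2 (t0 - t)" if "t \<in> {0..t0}" for t
    using deriv_sym[OF D(2) u1_anti that] by simp
  then have w_sym: "w t = 1 * w (t0 - t)" if "t \<in> {0..t0}" for t
    using that unfolding w_def by (metis mult_1)
  have ends: "0 \<in> {0..t0}" using \<open>t0 > 0\<close> by simp
  \<comment> \<open>This is where symmetry enters the extension: these are the gluing conditions for
    the first derivatives. The other functions involved vanish at both ends.\<close>
  have u1_ends: "u1 t0 = - u1 0" and w1_ends: "w1 t0 = - w1 0"
    using u1_anti[OF ends] deriv_sym[OF D(3) w_sym ends] by simp_all
  define X where "X = antiperiodic_ext t0"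
  have w2_ends: "w2 0 = 0" "w2 t0 = 0" using w2 assms by auto
  have DX: "(X u has_real_derivative X u1 t) (at t)" "(X u1 has_real_derivative X u2 t) (at t)"
    "(X w has_real_derivative X w1 t) (at t)" "(X w1 has_real_derivative X w2 t) (at t)" for t
    unfolding X_def
    using DERIV_antiperiodic_ext[OF \<open>t0 > 0\<close> D(1)] DERIV_antiperiodic_ext[OF \<open>t0 > 0\<close> D(2)]
      DERIV_antiperiodic_ext[OF \<open>t0 > 0\<close> D(3)] DERIV_antiperiodic_ext[OF \<open>t0 > 0\<close> D(4)]
      u1_ends w1_ends w_ends w2_ends u2_ends assms by auto
  have contX: "continuous_on UNIV (X u1)" "continuous_on UNIV (X u2)"
    "continuous_on UNIV (X w1)" "continuous_on UNIV (X w2)"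
    unfolding X_def using continuous_antiperiodic_ext[OF \<open>t0 > 0\<close>] cont
      u1_ends w1_ends w2_ends u2_ends by auto
  note XC1 = C1_on_UNIV_I[OF DX(1) contX(1)] C1_on_UNIV_I[OF DX(2) contX(2)]
    C1_on_UNIV_I[OF DX(3) contX(3)] C1_on_UNIV_I[OF DX(4) contX(4)]
  \<comment> \<open>The signed power is odd, so it commutes with the sign changes of the
    extension.\<close>
  have Xw: "(\<lambda>t. sgn_pow p (X u2 t)) = X w"
    unfolding X_def w_def by (intro ext odd_antiperiodic_ext) (rule sgn_pow_minus)
  \<comment> \<open>The equation for \<open>w2\<close> is known only on the original interval, so it
    is used at the base point \<open>x\<close> and carried back to \<open>t\<close> by the common
    sign \<open>c\<close>; oddness then moves the nonlinearity outside the extension.\<close>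
  have Xw2: "X w2 t = lam * sgn_pow q (X u t)" for t
  proof -
    obtain c x where "0 \<le> x" "x < t0" and c: "\<And>f. X f t = c * X f x"
      unfolding X_def using antiperiodic_ext_decompose[OF \<open>t0 > 0\<close>, of t] by metis
    have "X w2 t = c * w2 x" using \<open>0 \<le> x\<close> \<open>x < t0\<close> c by (simp add: X_def antiperiodic_ext_base)
    also have "\<dots> = c * X (\<lambda>t. lam * sgn_pow q (u t)) x"
      using \<open>0 \<le> x\<close> \<open>x < t0\<close> w2 by (simp add: X_def antiperiodic_ext_base)
    also have "\<dots> = X (\<lambda>t. lam * sgn_pow q (u t)) t" using c by simp
    also have "\<dots> = lam * sgn_pow q (X u t)"
      unfolding X_def by (subst odd_antiperiodic_ext[of "\<lambda>x. lam * sgn_pow q x"]) (simp_all add: sgn_pow_minus)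
    finally show ?thesis .
  qed
  have "is_solution_on UNIV p q lam (X u)"
    unfolding is_solution_on_def Let_def XC1 Xw using XC1 Xw2 by auto
  moreover have "\<forall>t\<in>{0..t0}. X u t = u t"
    unfolding X_def using antiperiodic_ext_closed assms by auto
  moreover have "X u (t + 2 * t0) = X u t" for t
    unfolding X_def using antiperiodic_ext_shift[OF \<open>t0 > 0\<close>, of u t 2] by simp
  moreover have "\<forall>t. 0 < t \<and> t < t0 / 2 \<longrightarrow> u t = u (t0 - t)"
    by (intro allI impI sym) auto
  ultimately show ?thesis using XC1(1) by blast
qed

end
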